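(* Let $G=(V,E)$ be a finite connected simple graph with $n=|V|\ge2$ and diameter $D$. Let $1<p<\infty$, let $f_0\in[-1,1]^V$, and let $0<\epsilon\le1$. Then $$\mathbb{E}\,\tau_p(\epsilon;f_0)\ \le\ \frac{n}{\lambda_p(G)}\left[\log\!\left(\frac{2^p\,|E|\,D^{p-1}}{\epsilon^p}\right)+3\right].$$
   Context: Dynamics: a profile is a function $f:V\to\mathbb{R}$. For $u\in V$, $f^{\#u}$ is the profile that equals $f$ off $u$ and whose value at $u$ is the unique minimizer over $x\in\mathbb{R}$ of $\sum_{v\sim u}|x-f(v)|^p$. Let $U_1,U_2,\ldots$ be independent uniformly distributed vertices of $V$; starting from a deterministic profile $f_0$ set $f_t=f_{t-1}^{\#U_t}$ for $t\ge1$. Let $\operatorname{osc}(f)=\max_V f-\min_V f$ and $\tau_p(\epsilon;f_0)=\min\{t\ge0:\operatorname{osc}(f_t)\le\epsilon\}$ (equal to $\infty$ if the set is empty). $\mathbb{E}$ is expectation over $(U_t)$. Logarithms are natural. Relaxation gap: let $\mathcal{E}_p(f)=\sum_{\{u,v\}\in E}|f(u)-f(v)|^p$ (each edge counted once), $\mathcal{D}_p(f,u)=\mathcal{E}_p(f)-\mathcal{E}_p(f^{\#u})$, and $$\lambda_p(G)=\inf_{\mathcal{E}_p(f)>0}\frac{\sum_{u\in V}\mathcal{D}_p(f,u)}{\mathcal{E}_p(f)}.$$ *)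

theory Defs
  imports "HOL-Probability.Probability"
begin

text \<open>A graph is given by a vertex set \<open>V\<close> and a set \<open>E\<close> of two-element subsets of \<open>V\<close>.
  Profiles are total functions on the ambient type; for a simple graph and updates at vertices
  of \<open>V\<close>, only their values on \<open>V\<close> enter the notions below.\<close>

definition simple_graph :: "'a set \<Rightarrow> 'a set set \<Rightarrow> bool" where
  "simple_graph V E \<longleftrightarrow> (\<forall>e\<in>E. e \<subseteq> V \<and> card e = 2)"

definition adj_rel :: "'a set set \<Rightarrow> ('a \<times> 'a) set" where
  "adj_rel E = {(u, v). {u, v} \<in> E}"

definition graph_connected :: "'a set \<Rightarrow> 'a set set \<Rightarrow> bool" where
  "graph_connected V E \<longleftrightarrow> (\<forall>u\<in>V. \<forall>v\<in>V. (u, v) \<in> (adj_rel E)\<^sup>*)"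

text \<open>The length of a shortest walk; meaningful only if \<open>v\<close> is reachable from \<open>u\<close>.\<close>

definition graph_dist :: "'a set set \<Rightarrow> 'a \<Rightarrow> 'a \<Rightarrow> nat" where
  "graph_dist E u v = (LEAST k. (u, v) \<in> adj_rel E ^^ k)"

definition graph_diameter :: "'a set \<Rightarrow> 'a set set \<Rightarrow> nat" where
  "graph_diameter V E = Max {graph_dist E u v | u v. u \<in> V \<and> v \<in> V}"

definition local_energy :: "real \<Rightarrow> 'a set set \<Rightarrow> ('a \<Rightarrow> real) \<Rightarrow> 'a \<Rightarrow> real \<Rightarrow> real" where
  "local_energy p E f u x = (\<Sum>v | {u, v} \<in> E. \<bar>x - f v\<bar> powr p)"

text \<open>The profile \<open>f\<^sup>#\<^sup>u\<close>. The minimizer is unique when \<open>p > 1\<close> and \<open>u\<close> has a positive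
  finite number of neighbours.\<close>

definition update :: "real \<Rightarrow> 'a set set \<Rightarrow> ('a \<Rightarrow> real) \<Rightarrow> 'a \<Rightarrow> 'a \<Rightarrow> real" where
  "update p E f u = f(u := (THE x. is_arg_min (local_energy p E f u) (\<lambda>_. True) x))"

text \<open>The profile \<open>f\<^sub>t\<close> obtained from \<open>f\<^sub>0\<close> along the vertex sequence \<open>us 1, us 2, \<dots>\<close>;
  the entry \<open>us 0\<close> is not used.\<close>

primrec trajectory ::
  "real \<Rightarrow> 'a set set \<Rightarrow> ('a \<Rightarrow> real) \<Rightarrow> (nat \<Rightarrow> 'a) \<Rightarrow> nat \<Rightarrow> 'a \<Rightarrow> real" where
  "trajectory p E f0 us 0 = f0"
| "trajectory p E f0 us (Suc t) = update p E (trajectory p E f0 us t) (us (Suc t))"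

definition osc :: "'a set \<Rightarrow> ('a \<Rightarrow> real) \<Rightarrow> real" where
  "osc V f = Max (f ` V) - Min (f ` V)"

text \<open>The infimum of a nonempty set in \<^typ>\<open>enat\<close> is its minimum, and that of the empty set
  is \<open>\<infinity>\<close>.\<close>

definition hitting_time ::
  "real \<Rightarrow> 'a set \<Rightarrow> 'a set set \<Rightarrow> real \<Rightarrow> ('a \<Rightarrow> real) \<Rightarrow> (nat \<Rightarrow> 'a) \<Rightarrow> enat" where
  "hitting_time p V E \<epsilon> f0 us = Inf {enat t | t. osc V (trajectory p E f0 us t) \<le> \<epsilon>}"

definition edge_diff :: "('a \<Rightarrow> real) \<Rightarrow> 'a set \<Rightarrow> real" where
  "edge_diff f e = (THE d. \<exists>u v. e = {u, v} \<and> d = \<bar>f u - f v\<bar>)"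

lemma edge_diff_pair: "edge_diff f {u, v} = \<bar>f u - f v\<bar>"
  unfolding edge_diff_def by (rule the_equality) (auto simp: doubleton_eq_iff abs_minus_commute)

definition energy :: "real \<Rightarrow> 'a set set \<Rightarrow> ('a \<Rightarrow> real) \<Rightarrow> real" where
  "energy p E f = (\<Sum>e\<in>E. edge_diff f e powr p)"

definition energy_drop :: "real \<Rightarrow> 'a set set \<Rightarrow> ('a \<Rightarrow> real) \<Rightarrow> 'a \<Rightarrow> real" where
  "energy_drop p E f u = energy p E f - energy p E (update p E f u)"

definition relaxation_gap :: "real \<Rightarrow> 'a set \<Rightarrow> 'a set set \<Rightarrow> real" where
  "relaxation_gap p V E =
     (INF f \<in> {f. energy p E f > 0}. (\<Sum>u\<in>V. energy_drop p E f u) / energy p E f)"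

end

theory Submission
  imports Defs
begin

text \<open>The energy is a Lyapunov function for the dynamics. By the definition of the relaxation gap
  \<open>\<lambda>\<close>, one update at a uniformly chosen vertex multiplies the expected energy by at most
  \<open>1 - \<lambda>/n\<close> (\<open>sum_energy_update_le\<close>, iterated in \<open>sum_energy_trajectory_le\<close>). The initial energy
  is at most \<open>2\<^sup>p |E|\<close>, because a profile with values in \<open>[-1,1]\<close> has oscillation at most 2. In the
  other direction, summing the differences along a shortest path between a minimum and a maximum
  and applying the power mean inequality gives \<open>osc\<^sup>p \<le> D\<^sup>p\<^sup>-\<^sup>1 energy\<close>
  (\<open>osc_powr_le_energy\<close>). Markov's inequality therefore bounds the probability that the oscillation
  still exceeds \<open>\<epsilon>\<close> at time \<open>t\<close> by \<open>min 1 (A (1 - \<lambda>/n)\<^sup>t)\<close>, where \<open>A\<close> is the argument of the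
  logarithm in the theorem. The expected hitting time is at most the sum of these probabilities:
  the first \<open>n/\<lambda> log A\<close> terms, rounded up, are bounded by 1, and the remaining ones form a
  geometric series with sum at most \<open>n/\<lambda>\<close>. Since \<open>\<lambda> \<le> n\<close>, rounding up costs at most another
  \<open>n/\<lambda>\<close> (\<open>suminf_ennreal_geometric_tail_le\<close>).

  Two facts about the deterministic dynamics support this. The update is a genuine minimizer,
  since the local energy is coercive and strictly convex (\<open>ex1_arg_min_local_energy\<close>). And the
  relaxation gap is positive (\<open>relaxation_gap_pos\<close>), so that the division by \<open>\<lambda>\<close> is meaningful.
  For the latter, every nonconstant profile can be improved at a vertex where it is maximal and
  which has a neighbour with a smaller value. After normalizing the profile to have values in
  \<open>[0,1]\<close> with both ends attained, compactness of the cube makes the improvement uniform, and both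
  the energy drop and the energy scale like \<open>osc\<^sup>p\<close>.

  The first \<open>t\<close> updates involve a word in \<open>V\<^sup>t\<close>, and all words are equally likely, so expectations
  at time \<open>t\<close> are handled as averages over the finite set \<open>PiE {1..t} (\<lambda>_. V)\<close>.\<close>

section \<open>Convexity of the \<open>p\<close>-th power\<close>

text \<open>Strictness gives uniqueness of the minimizer below. Including \<open>t = 0\<close>, where the power need not
  be twice differentiable, makes the inequality applicable to edges along which a profile is
  constant; the mean value theorem only requires differentiability in the interior.\<close>

lemma powr_above_tangent:
  fixes c t p :: real
  assumes "1 < p" "0 < c" "0 \<le> t" "t \<noteq> c"
  shows "c powr p + p * c powr (p - 1) * (t - c) < t powr p"
proof -
  have mvt: "\<exists>z. a < z \<and> z < b \<and> b powr p - a powr p = (b - a) * (p * z powr (p - 1))"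
    if "0 \<le> a" "a < b" for a b :: real
  proof -
    have D: "((\<lambda>x. x powr p) has_real_derivative p * x powr (p - 1)) (at x)" if "a < x" for x
      using that \<open>0 \<le> a\<close> \<open>1 < p\<close> by (auto intro!: derivative_eq_intros)
    have cont: "continuous_on {a..b} (\<lambda>x. x powr p)"
      using \<open>0 \<le> a\<close> \<open>1 < p\<close> by (intro continuous_on_powr' continuous_intros) auto
    obtain l z where z: "a < z" "z < b" "DERIV (\<lambda>x. x powr p) z :> l"
        "b powr p - a powr p = (b - a) * l"
      using MVT[OF \<open>a < b\<close> cont] D real_differentiable_def by blast
    moreover have "l = p * z powr (p - 1)"
      using DERIV_unique[OF z(3) D[OF z(1)]] .
    ultimately show ?thesis by blast
  qed
  show ?thesis
  proof (cases "c < t")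
    case True
    then obtain z where z: "c < z" "t powr p - c powr p = (t - c) * (p * z powr (p - 1))"
      using mvt[of c t] assms by auto
    have "c powr (p - 1) < z powr (p - 1)"
      using z assms by (intro powr_less_mono2) auto
    then have "(t - c) * (p * c powr (p - 1)) < (t - c) * (p * z powr (p - 1))"
      using True assms by simp
    then show ?thesis using z(2) by (simp add: algebra_simps)
  next
    case False
    then have "t < c" using assms by simp
    then obtain z where z: "t < z" "z < c" "c powr p - t powr p = (c - t) * (p * z powr (p - 1))"
      using mvt[of t c] assms by auto
    have "z powr (p - 1) < c powr (p - 1)"
      using z assms by (intro powr_less_mono2) auto
    then have "(c - t) * (p * z powr (p - 1)) < (c - t) * (p * c powr (p - 1))"
      using \<open>t < c\<close> assms by simp
    then show ?thesis using z(3) by (simp add: algebra_simps)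
  qed
qed

text \<open>If the absolute values differ, the tangent at their mean separates them strictly. If they
  coincide, the two numbers are opposite and the left-hand side vanishes.\<close>

lemma abs_powr_midpoint_less:
  fixes x y p :: real
  assumes "1 < p" "x \<noteq> y"
  shows "\<bar>(x + y) / 2\<bar> powr p < (\<bar>x\<bar> powr p + \<bar>y\<bar> powr p) / 2"
proof (cases "\<bar>x\<bar> = \<bar>y\<bar>")
  case True
  then have "x + y = 0" "x \<noteq> 0" using assms by auto
  then show ?thesis by (simp add: add_pos_pos)
next
  case False
  define c where "c = (\<bar>x\<bar> + \<bar>y\<bar>) / 2"
  have c: "0 < c" "\<bar>x\<bar> \<noteq> c" "\<bar>y\<bar> \<noteq> c" using False by (auto simp: c_def field_simps)
  have "\<bar>(x + y) / 2\<bar> powr p \<le> c powr p"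
    using assms by (intro powr_mono2) (auto simp: c_def)
  moreover have "c powr p + p * c powr (p - 1) * (\<bar>x\<bar> - c) < \<bar>x\<bar> powr p"
    "c powr p + p * c powr (p - 1) * (\<bar>y\<bar> - c) < \<bar>y\<bar> powr p"
    using c assms by (auto intro!: powr_above_tangent)
  moreover have "p * c powr (p - 1) * (\<bar>x\<bar> - c) + p * c powr (p - 1) * (\<bar>y\<bar> - c) = 0"
    by (simp add: c_def field_simps)
  ultimately show ?thesis by simp
qed

text \<open>Jensen's inequality for the \<open>p\<close>-th power on the closed half-line: the terms linear in \<open>x i - c\<close>
  of the tangent at the mean \<open>c\<close> cancel in the sum.\<close>

lemma powr_sum_le_card_powr_mult_sum:
  fixes x :: "'b \<Rightarrow> real"
  assumes "1 < p" "finite I" and nonneg: "\<And>i. i \<in> I \<Longrightarrow> 0 \<le> x i"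
  shows "(\<Sum>i\<in>I. x i) powr p \<le> real (card I) powr (p - 1) * (\<Sum>i\<in>I. x i powr p)"
proof (cases "(\<Sum>i\<in>I. x i) = 0")
  case True
  then show ?thesis using assms by (simp add: sum_nonneg)
next
  case False
  then have I: "I \<noteq> {}" and pos: "(\<Sum>i\<in>I. x i) > 0"
    using sum_nonneg[of I x] nonneg by (auto simp: less_le)
  define k where "k = real (card I)"
  have k: "k > 0" using I \<open>finite I\<close> by (simp add: k_def card_gt_0_iff)
  define c where "c = (\<Sum>i\<in>I. x i) / k"
  have c: "c > 0" and ck: "(\<Sum>i\<in>I. x i) = k * c" using pos k by (auto simp: c_def)
  have "k * c powr p = (\<Sum>i\<in>I. c powr p + p * c powr (p - 1) * (x i - c))"
    by (simp add: sum.distrib sum_distrib_left[symmetric] sum_subtractf ck k_def)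
  also have "\<dots> \<le> (\<Sum>i\<in>I. x i powr p)"
  proof (rule sum_mono)
    fix i assume "i \<in> I"
    then show "c powr p + p * c powr (p - 1) * (x i - c) \<le> x i powr p"
      using powr_above_tangent[of p c "x i"] assms c by (cases "x i = c") auto
  qed
  finally have "k powr (p - 1) * (k * c powr p) \<le> k powr (p - 1) * (\<Sum>i\<in>I. x i powr p)"
    by (rule mult_left_mono) simp
  moreover have "k powr (p - 1) * (k * c powr p) = (k * c) powr p"
    using k c powr_mult_base[of k "p - 1"] by (simp add: powr_mult mult_ac)
  ultimately show ?thesis by (simp add: ck k_def)
qed

lemma continuous_on_abs_powr [continuous_intros]:
  assumes "continuous_on S g" "0 < (p::real)"
  shows "continuous_on S (\<lambda>x. \<bar>g x :: real\<bar> powr p)"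
  using assms by (intro continuous_on_powr' continuous_intros) auto

section \<open>Finite connected graphs\<close>

locale finite_connected_graph =
  fixes V :: "'a set" and E :: "'a set set"
  assumes finite_V: "finite V" and simple: "simple_graph V E"
    and connected: "graph_connected V E" and two_vertices: "card V \<ge> 2"
begin

lemma edge_doubleton: "e \<in> E \<Longrightarrow> \<exists>u v. e = {u, v}"
  using simple unfolding simple_graph_def card_2_iff by blast

lemma edge_ends:
  assumes "{u, v} \<in> E"
  shows "u \<in> V" "v \<in> V" "u \<noteq> v"
proof -
  have "{u, v} \<subseteq> V" "card {u, v} = 2" using assms simple by (auto simp: simple_graph_def)
  then show "u \<in> V" "v \<in> V" "u \<noteq> v" by auto
qed

lemma finite_E: "finite E"
  using finite_V simple by (intro finite_subset[of E "Pow V"]) (auto simp: simple_graph_def)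

lemma finite_nbrs: "finite {v. {u, v} \<in> E}"
  by (rule finite_subset[OF _ finite_V]) (blast dest: edge_ends(2))

lemma exists_other_vertex: "\<exists>v\<in>V. v \<noteq> u"
proof (rule ccontr)
  assume "\<not> ?thesis"
  then have "V \<subseteq> {u}" by auto
  then have "card V \<le> card {u}" by (intro card_mono) auto
  then show False using two_vertices by simp
qed

lemma boundary_edge:
  assumes "a \<in> A" "a \<in> V" "b \<in> V" "b \<notin> A"
  shows "\<exists>u w. u \<in> A \<and> w \<notin> A \<and> {u, w} \<in> E"
proof -
  have "(a, b) \<in> (adj_rel E)\<^sup>*" using connected assms by (auto simp: graph_connected_def)
  then have "a \<in> A \<longrightarrow> b \<notin> A \<longrightarrow> (\<exists>u w. u \<in> A \<and> w \<notin> A \<and> {u, w} \<in> E)"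
    by (induction rule: rtrancl_induct) (auto simp: adj_rel_def)
  then show ?thesis using assms by blast
qed

lemma nbr_exists:
  assumes "u \<in> V"
  shows "\<exists>w. {u, w} \<in> E"
proof -
  obtain v where "v \<in> V" "v \<noteq> u" using exists_other_vertex by blast
  then show ?thesis using boundary_edge[of u "{u}" v] assms by auto
qed

lemma V_nonempty: "V \<noteq> {}" using two_vertices by auto

lemma E_nonempty: "E \<noteq> {}"
  using V_nonempty nbr_exists by blast

end

section \<open>The energy drop of an update\<close>

text \<open>A single neighbour \<open>w\<close> makes the local energy coercive: at distance \<open>R\<close> from \<open>f w\<close> its term
  alone reaches the value of the local energy at \<open>f w\<close>. So a minimum over the compact interval of
  radius \<open>R\<close> is global, and strict midpoint convexity makes it unique.\<close>

lemma ex1_arg_min_local_energy: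
  fixes p :: real
  assumes "1 < p" and fin: "finite {v. {u, v} \<in> E}" and w: "{u, w} \<in> E"
  shows "\<exists>!x. is_arg_min (local_energy p E f u) (\<lambda>_. True) x"
proof -
  let ?L = "local_energy p E f u"
  define R where "R = ?L (f w) powr (1 / p)"
  have nonneg: "0 \<le> ?L x" for x by (auto simp: local_energy_def intro: sum_nonneg)
  have Rp: "R powr p = ?L (f w)" using \<open>1 < p\<close> nonneg by (simp add: R_def powr_powr)
  have R0: "0 \<le> R" by (simp add: R_def)
  have ge: "\<bar>x - f w\<bar> powr p \<le> ?L x" for x
    using fin w unfolding local_energy_def by (intro member_le_sum) auto
  have "continuous_on {f w - R..f w + R} ?L"
    unfolding local_energy_def using \<open>1 < p\<close> by (intro continuous_intros) auto
  then obtain m where m: "m \<in> {f w - R..f w + R}" "\<And>x. x \<in> {f w - R..f w + R} \<Longrightarrow> ?L m \<le> ?L x"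
    using continuous_attains_inf[of "{f w - R..f w + R}" ?L] R0 by auto
  have "?L m \<le> ?L x" for x
  proof (cases "x \<in> {f w - R..f w + R}")
    case False
    then have "R \<le> \<bar>x - f w\<bar>" by auto
    then have "R powr p \<le> \<bar>x - f w\<bar> powr p" using R0 \<open>1 < p\<close> by (intro powr_mono2) auto
    then have "?L (f w) \<le> ?L x" using ge[of x] Rp by linarith
    moreover have "?L m \<le> ?L (f w)" using m R0 by auto
    ultimately show ?thesis by linarith
  qed (use m in auto)
  moreover have "x = y" if "\<And>z. ?L x \<le> ?L z" "\<And>z. ?L y \<le> ?L z" for x y
  proof (rule ccontr)
    assume "x \<noteq> y"
    have "?L ((x + y) / 2) < (\<Sum>v | {u, v} \<in> E. (\<bar>x - f v\<bar> powr p + \<bar>y - f v\<bar> powr p) / 2)"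
      unfolding local_energy_def
    proof (rule sum_strict_mono)
      fix v
      show "\<bar>(x + y) / 2 - f v\<bar> powr p < (\<bar>x - f v\<bar> powr p + \<bar>y - f v\<bar> powr p) / 2"
        using abs_powr_midpoint_less[of p "x - f v" "y - f v"] \<open>1 < p\<close> \<open>x \<noteq> y\<close>
        by (simp add: field_simps)
    qed (use fin w in auto)
    also have "\<dots> = (?L x + ?L y) / 2"
      by (simp add: local_energy_def sum.distrib flip: sum_divide_distrib)
    finally show False using that(1)[of "(x + y) / 2"] that(2)[of "(x + y) / 2"] by simp
  qed
  ultimately show ?thesis
    unfolding is_arg_min_linorder by (intro ex1I[of _ m]) auto
qed

context finite_connected_graph
begin

lemma update_minimizes_local_energy:
  assumes "1 < p" "u \<in> V"
  shows "local_energy p E f u (update p E f u u) \<le> local_energy p E f u x"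
proof -
  obtain w where "{u, w} \<in> E" using nbr_exists assms by blast
  then have "is_arg_min (local_energy p E f u) (\<lambda>_. True) (update p E f u u)"
    using theI'[OF ex1_arg_min_local_energy[OF \<open>1 < p\<close> finite_nbrs, of u _ f]]
    by (simp add: update_def)
  then show ?thesis by (simp add: is_arg_min_linorder)
qed

text \<open>Only the edges at \<open>u\<close> feel the change of the value at \<open>u\<close>, and they correspond to the
  neighbours of \<open>u\<close>. Hence the drop of the energy is the drop of the local energy.\<close>

lemma energy_fun_upd:
  "energy p E (f(u := x)) = local_energy p E f u x + (\<Sum>e | e \<in> E \<and> u \<notin> e. edge_diff f e powr p)"
proof -
  have "energy p E (f(u := x)) = (\<Sum>e | e \<in> E \<and> u \<in> e. edge_diff (f(u := x)) e powr p)
      + (\<Sum>e | e \<in> E \<and> u \<notin> e. edge_diff (f(u := x)) e powr p)"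
    unfolding energy_def
    by (subst sum.Int_Diff[OF finite_E, of _ "{e. u \<in> e}"]) (simp add: Int_def set_diff_eq)
  also have "(\<Sum>e | e \<in> E \<and> u \<notin> e. edge_diff (f(u := x)) e powr p)
      = (\<Sum>e | e \<in> E \<and> u \<notin> e. edge_diff f e powr p)"
  proof (rule sum.cong)
    fix e assume e: "e \<in> {e \<in> E. u \<notin> e}"
    then obtain v w where "e = {v, w}" using edge_doubleton by blast
    with e show "edge_diff (f(u := x)) e powr p = edge_diff f e powr p"
      by (auto simp: edge_diff_pair)
  qed simp
  also have "(\<Sum>e | e \<in> E \<and> u \<in> e. edge_diff (f(u := x)) e powr p) = local_energy p E f u x"
    unfolding local_energy_def
  proof (rule sum.reindex_cong[where l = "\<lambda>v. {u, v}"])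
    show "inj_on (\<lambda>v. {u, v}) {v. {u, v} \<in> E}"
      by (auto simp: inj_on_def doubleton_eq_iff)
    show "{e \<in> E. u \<in> e} = (\<lambda>v. {u, v}) ` {v. {u, v} \<in> E}"
    proof (intro subset_antisym subsetI)
      fix e assume e: "e \<in> {e \<in> E. u \<in> e}"
      then obtain v w where "e = {v, w}" using edge_doubleton by blast
      with e have "e = {u, v} \<or> e = {u, w}" by auto
      with e show "e \<in> (\<lambda>v. {u, v}) ` {v. {u, v} \<in> E}" by auto
    qed auto
    show "edge_diff (f(u := x)) {u, v} powr p = \<bar>x - f v\<bar> powr p" if "v \<in> {v. {u, v} \<in> E}" for v
      using edge_ends(3)[of u v] that by (auto simp: edge_diff_pair)
  qed
  finally show ?thesis .
qed

lemma energy_drop_eq: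
  "energy_drop p E f u = local_energy p E f u (f u) - local_energy p E f u (update p E f u u)"
proof -
  have upd: "f(u := update p E f u u) = update p E f u" by (simp add: update_def)
  show ?thesis
    using energy_fun_upd[of p f u "f u", unfolded fun_upd_triv]
      energy_fun_upd[of p f u "update p E f u u", unfolded upd]
    unfolding energy_drop_def by linarith
qed

text \<open>A lower bound for the drop only requires one good value \<open>x\<close>; the minimizer, in general without closed
  form, need not be known.\<close>

lemma energy_drop_ge:
  assumes "1 < p" "u \<in> V"
  shows "local_energy p E f u (f u) - local_energy p E f u x \<le> energy_drop p E f u"
  using update_minimizes_local_energy[OF assms, of f x] by (simp add: energy_drop_eq)

lemma energy_drop_nonneg: "1 < p \<Longrightarrow> u \<in> V \<Longrightarrow> 0 \<le> energy_drop p E f u"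
  using energy_drop_ge[of p u f "f u"] by simp

lemma energy_nonneg: "0 \<le> energy p E f"
  by (auto simp: energy_def intro: sum_nonneg)

lemma energy_drop_le_energy: "energy_drop p E f u \<le> energy p E f"
  using energy_nonneg by (simp add: energy_drop_def)

section \<open>Positivity of the relaxation gap\<close>

text \<open>Take a vertex \<open>u\<close> at the maximum with a neighbour \<open>w\<close> that lies lower by \<open>d > 0\<close>, and lower the
  value at \<open>u\<close> by \<open>h \<le> d\<close>. The edge to \<open>w\<close> gains at least \<open>h d\<^sup>p\<^sup>-\<^sup>1\<close>. Every other edge loses at most
  \<open>h\<^sup>p\<close>, which is of smaller order in \<open>h\<close> because \<open>p > 1\<close>.\<close>

lemma exists_local_improvement:
  assumes "1 < p" "a \<in> V" "b \<in> V" "f a < f b"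
  shows "\<exists>u\<in>V. \<exists>x. local_energy p E f u x < local_energy p E f u (f u)"
proof -
  define m where "m = Max (f ` V)"
  have le_m: "f v \<le> m" if "v \<in> V" for v using that finite_V by (simp add: m_def)
  have "m \<in> f ` V" unfolding m_def using finite_V V_nonempty by (intro Max_in) auto
  then obtain c where "c \<in> V" "f c = m" by auto
  moreover have "f a < m" using assms le_m[of b] by simp
  ultimately obtain u w where u: "f u = m" and w: "f w \<noteq> m" and uw: "{u, w} \<in> E"
    using boundary_edge[of c "{v. f v = m}" a] assms by auto
  have in_V: "u \<in> V" "w \<in> V" using edge_ends[OF uw] by auto
  define d where "d = m - f w"
  have d: "d > 0" using le_m[OF in_V(2)] w by (simp add: d_def)
  define N where "N = real (card {v. {u, v} \<in> E})"
  have N: "N \<ge> 0" by (simp add: N_def)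
  \<comment> \<open>Chosen so that \<open>h\<^sup>p\<^sup>-\<^sup>1 (N + 1) = d\<^sup>p\<^sup>-\<^sup>1\<close>: the loss of \<open>N\<close> edges stays below the gain.\<close>
  define h where "h = d * (N + 1) powr (- 1 / (p - 1))"
  have h0: "h > 0" using d N by (simp add: h_def)
  have "(N + 1) powr (- 1 / (p - 1)) \<le> (N + 1) powr 0"
    using N \<open>1 < p\<close> by (intro powr_mono) (auto simp: field_simps)
  then have hd: "h \<le> d" using d N by (simp add: h_def mult_left_le)
  have hp: "h powr (p - 1) * (N + 1) = d powr (p - 1)"
  proof -
    have "((N + 1) powr (- 1 / (p - 1))) powr (p - 1) = (N + 1) powr (- 1)"
      using \<open>1 < p\<close> by (simp add: powr_powr)
    then have "h powr (p - 1) = d powr (p - 1) * (N + 1) powr (- 1)"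
      using d N by (simp add: h_def powr_mult)
    then show ?thesis using N by (simp add: powr_minus)
  qed
  have split: "y powr p = y * y powr (p - 1)" if "0 \<le> y" for y
    using powr_mult_base[OF that, of "p - 1"] by simp
  let ?nb = "{v. {u, v} \<in> E}"
  let ?gain = "\<lambda>v. \<bar>m - f v\<bar> powr p - \<bar>m - h - f v\<bar> powr p"
  have gain: "- (h powr p) \<le> ?gain v" if "v \<in> ?nb" for v
  proof -
    have "f v \<le> m" using that edge_ends(2) le_m by blast
    then consider "\<bar>m - h - f v\<bar> \<le> \<bar>m - f v\<bar>" | "\<bar>m - h - f v\<bar> \<le> h" using h0 by linarith
    then show ?thesis
    proof cases
      case 1
      then have "\<bar>m - h - f v\<bar> powr p \<le> \<bar>m - f v\<bar> powr p" using \<open>1 < p\<close> by (intro powr_mono2) auto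
      then show ?thesis using powr_ge_zero[of h p] by linarith
    next
      case 2
      then have "\<bar>m - h - f v\<bar> powr p \<le> h powr p" using \<open>1 < p\<close> by (intro powr_mono2) auto
      then show ?thesis using powr_ge_zero[of "\<bar>m - f v\<bar>" p] by linarith
    qed
  qed
  have gain_w: "h * d powr (p - 1) \<le> ?gain w"
  proof -
    have "(d - h) powr p = (d - h) * (d - h) powr (p - 1)" using hd by (intro split) auto
    also have "\<dots> \<le> (d - h) * d powr (p - 1)"
      using hd h0 \<open>1 < p\<close> by (intro mult_left_mono powr_mono2) auto
    finally have "h * d powr (p - 1) \<le> d powr p - (d - h) powr p"
      using split[of d] d by (simp add: algebra_simps)
    moreover have "\<bar>m - f w\<bar> = d" "\<bar>m - h - f w\<bar> = d - h" using d hd by (auto simp: d_def)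
    ultimately show ?thesis by simp
  qed
  have "(\<Sum>v\<in>?nb. ?gain v) = ?gain w + (\<Sum>v\<in>?nb - {w}. ?gain v)"
    using finite_nbrs uw by (intro sum.remove) auto
  moreover have "(\<Sum>v\<in>?nb - {w}. ?gain v) \<ge> (\<Sum>v\<in>?nb - {w}. - (h powr p))"
    using gain by (intro sum_mono) auto
  moreover have "(\<Sum>v\<in>?nb - {w}. - (h powr p)) \<ge> - (N * h powr p)"
    by (simp add: N_def mult_right_mono card_mono finite_nbrs)
  moreover have "N * h powr p < h * d powr (p - 1)"
    using split[of h] h0 hp[symmetric] by (simp add: algebra_simps)
  ultimately have "0 < (\<Sum>v\<in>?nb. ?gain v)" using gain_w by linarith
  then show ?thesis
    using in_V u by (intro bexI[of _ u] exI[of _ "m - h"]) (simp_all add: local_energy_def sum_subtractf)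
qed

end

lemma compact_unit_cube: "compact {f :: 'a \<Rightarrow> real. \<forall>v. f v \<in> {0..1}}"
proof -
  have "compactin (product_topology (\<lambda>_::'a. euclideanreal) UNIV) (PiE UNIV (\<lambda>_. {0..1}))"
    unfolding compactin_PiE by simp
  moreover have "PiE UNIV (\<lambda>_. {0..1}) = {f :: 'a \<Rightarrow> real. \<forall>v. f v \<in> {0..1}}"
    by (auto simp: PiE_def Pi_def)
  ultimately show ?thesis by (simp add: euclidean_product_topology)
qed

lemma continuous_on_local_energy:
  assumes "0 < p" "continuous_on UNIV g"
  shows "continuous_on UNIV (\<lambda>f. local_energy p E f u (g f))"
  unfolding local_energy_def
  using assms by (intro continuous_on_sum continuous_on_abs_powr continuous_intros continuous_on_product_coordinates)

context finite_connected_graph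
begin

text \<open>The optimal drop is a supremum over candidate values of continuous functions of the profile, so
  the profiles with drop above a given threshold form an open set. By the existence of local
  improvements, these open sets exhaust the compact set of normalized profiles.\<close>

lemma uniform_improvement_between:
  assumes "1 < p" "a \<in> V" "b \<in> V"
  shows "\<exists>c>0. \<forall>f. (\<forall>v. f v \<in> {0..1}) \<longrightarrow> f a = 0 \<longrightarrow> f b = 1 \<longrightarrow>
    (\<exists>u\<in>V. \<exists>x. c \<le> local_energy p E f u (f u) - local_energy p E f u x)"
proof -
  define gain where "gain f u x = local_energy p E f u (f u) - local_energy p E f u x" for f u x
  define K where "K = {f. \<forall>v. f v \<in> {0..1}} \<inter> ({f. f a = 0} \<inter> {f :: 'a \<Rightarrow> real. f b = 1})"
  define G where "G k = (\<Union>u\<in>V. \<Union>x. {f. 1 / real (Suc k) < gain f u x})" for k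
  have "closed ({f. f a = 0} \<inter> {f :: 'a \<Rightarrow> real. f b = 1})"
    by (intro closed_Int closed_Collect_eq continuous_on_product_coordinates continuous_on_const)
  then have K: "compact K"
    unfolding K_def by (intro compact_Int_closed compact_unit_cube)
  have "open (G k)" for k
    unfolding G_def gain_def using \<open>1 < p\<close>
    by (intro open_UN ballI open_Collect_less continuous_on_diff continuous_on_local_energy
        continuous_on_product_coordinates continuous_on_const) auto
  moreover have "K \<subseteq> (\<Union>k. G k)"
  proof
    fix f assume "f \<in> K"
    then have "f a < f b" by (simp add: K_def)
    then obtain u x where u: "u \<in> V" "0 < gain f u x"
      using exists_local_improvement[OF assms] by (force simp: gain_def)
    obtain k where "1 / real (Suc k) < gain f u x"
      using nat_approx_posE[OF u(2)] by blast
    with u show "f \<in> (\<Union>k. G k)" by (auto simp: G_def)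
  qed
  ultimately obtain F where F: "finite F" "K \<subseteq> (\<Union>k\<in>F. G k)"
    using compactE_image[OF K, of UNIV G] by metis
  define c where "c = 1 / real (Suc (Max (insert 0 F)))"
  have "\<exists>u\<in>V. \<exists>x. c \<le> gain f u x" if "f \<in> K" for f
  proof -
    have "f \<in> (\<Union>k\<in>F. G k)" using F(2) that by blast
    then obtain k u x where k: "k \<in> F" "u \<in> V" "1 / real (Suc k) < gain f u x"
      unfolding G_def by blast
    have "k \<le> Max (insert 0 F)" using F k by (intro Max_ge) auto
    then have "c \<le> 1 / real (Suc k)" by (simp add: c_def frac_le)
    with k have "c \<le> gain f u x" by linarith
    with k show ?thesis by blast
  qed
  then show ?thesis by (intro exI[of _ c]) (auto simp: gain_def K_def c_def)
qed

text \<open>Scaling and translation reduce an arbitrary profile to a normalized one.\<close>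

lemma local_energy_affine:
  assumes "0 < s" "\<And>v. v \<in> V \<Longrightarrow> f v = m + s * g v"
  shows "local_energy p E f u (m + s * x) = s powr p * local_energy p E g u x"
  unfolding local_energy_def sum_distrib_left
proof (rule sum.cong)
  fix v assume "v \<in> {v. {u, v} \<in> E}"
  then have "v \<in> V" using edge_ends(2) by blast
  then have "m + s * x - f v = s * (x - g v)" using assms by (simp add: algebra_simps)
  then show "\<bar>m + s * x - f v\<bar> powr p = s powr p * \<bar>x - g v\<bar> powr p"
    using assms by (simp add: abs_mult powr_mult)
qed simp

lemma diff_le_osc:
  assumes "u \<in> V" "v \<in> V"
  shows "\<bar>f u - f v\<bar> \<le> osc V f"
proof -
  have "f w \<le> Max (f ` V)" "Min (f ` V) \<le> f w" if "w \<in> V" for w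
    using finite_V that by auto
  from this[OF assms(1)] this[OF assms(2)] show ?thesis by (simp add: osc_def)
qed

lemma osc_attained: "\<exists>a\<in>V. \<exists>b\<in>V. f a = Min (f ` V) \<and> f b = Max (f ` V)"
proof -
  have "Min (f ` V) \<in> f ` V" "Max (f ` V) \<in> f ` V"
    using finite_V V_nonempty by (auto intro: Min_in Max_in)
  then show ?thesis by auto
qed

lemma osc_nonneg: "0 \<le> osc V f"
  using osc_attained[of f] diff_le_osc[of _ _ f] by force

lemma energy_le_osc_powr:
  assumes "1 < p"
  shows "energy p E f \<le> real (card E) * osc V f powr p"
proof -
  have "edge_diff f e powr p \<le> osc V f powr p" if e: "e \<in> E" for e
  proof -
    obtain u v where uv: "e = {u, v}" using edge_doubleton[OF e] by blast
    then have "u \<in> V" "v \<in> V" using edge_ends[of u v] e by auto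
    then show ?thesis
      using \<open>1 < p\<close> diff_le_osc[of u v f] uv by (auto simp: edge_diff_pair intro: powr_mono2)
  qed
  then have "energy p E f \<le> (\<Sum>e\<in>E. osc V f powr p)"
    unfolding energy_def by (rule sum_mono)
  then show ?thesis by simp
qed

lemma energy_drop_ge_osc_powr:
  assumes "1 < p"
  shows "\<exists>c>0. \<forall>f. \<exists>u\<in>V. c * osc V f powr p \<le> energy_drop p E f u"
proof -
  have "\<forall>a\<in>V. \<forall>b\<in>V. \<exists>c>0. \<forall>f. (\<forall>v. f v \<in> {0..1}) \<longrightarrow> f a = 0 \<longrightarrow> f b = 1 \<longrightarrow>
    (\<exists>u\<in>V. \<exists>x. c \<le> local_energy p E f u (f u) - local_energy p E f u x)"
    using uniform_improvement_between[OF assms] by blast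
  then obtain C where C: "\<And>a b. a \<in> V \<Longrightarrow> b \<in> V \<Longrightarrow> 0 < C a b"
    "\<And>a b f. a \<in> V \<Longrightarrow> b \<in> V \<Longrightarrow> (\<forall>v. f v \<in> {0..1}) \<Longrightarrow> f a = 0 \<Longrightarrow> f b = 1 \<Longrightarrow>
      \<exists>u\<in>V. \<exists>x. C a b \<le> local_energy p E f u (f u) - local_energy p E f u x"
    by metis
  define c where "c = Min ((\<lambda>(a, b). C a b) ` (V \<times> V))"
  have c: "0 < c"
    unfolding c_def using C(1) finite_V V_nonempty by (subst Min_gr_iff) auto
  have c_le: "c \<le> C a b" if "a \<in> V" "b \<in> V" for a b
    unfolding c_def using that finite_V by (intro Min_le) auto
  have "\<exists>u\<in>V. c * osc V f powr p \<le> energy_drop p E f u" for f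
  proof (cases "osc V f = 0")
    case True
    then show ?thesis using V_nonempty energy_drop_nonneg[OF assms] by auto
  next
    case False
    define s where "s = osc V f"
    define m where "m = Min (f ` V)"
    have s: "s > 0" using False osc_nonneg[of f] by (simp add: s_def)
    define g where "g v = (if v \<in> V then (f v - m) / s else 0)" for v
    have fg: "f v = m + s * g v" if "v \<in> V" for v using that s by (simp add: g_def)
    obtain a b where ab: "a \<in> V" "b \<in> V" "f a = m" "f b = Max (f ` V)"
      using osc_attained[of f] by (auto simp: m_def)
    then have "g a = 0" "g b = 1" using s by (auto simp: g_def s_def osc_def m_def)
    moreover have "g v \<in> {0..1}" for v
    proof (cases "v \<in> V")
      case True
      then have "m \<le> f v" "f v - m \<le> s"
        using finite_V by (auto simp: m_def s_def osc_def)
      then show ?thesis using s True by (simp add: g_def)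
    qed (simp add: g_def)
    ultimately obtain u x where u: "u \<in> V"
      and x: "C a b \<le> local_energy p E g u (g u) - local_energy p E g u x"
      using C(2)[OF ab(1,2), of g] by blast
    have "c * s powr p \<le> s powr p * (local_energy p E g u (g u) - local_energy p E g u x)"
      using x c_le[OF ab(1,2)] by (subst mult.commute) (intro mult_left_mono, auto)
    also have "\<dots> = local_energy p E f u (m + s * g u) - local_energy p E f u (m + s * x)"
      using local_energy_affine[OF s fg] by (simp add: right_diff_distrib)
    also have "\<dots> = local_energy p E f u (f u) - local_energy p E f u (m + s * x)"
      using fg[OF u] by simp
    also have "\<dots> \<le> energy_drop p E f u"
      by (rule energy_drop_ge[OF assms u])
    finally show ?thesis using u by (auto simp: s_def)
  qed
  with c show ?thesis by blast
qed

lemma exists_positive_energy: "\<exists>f. 0 < energy p E f"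
proof -
  obtain e where e: "e \<in> E" using E_nonempty by blast
  then obtain u v where uv: "e = {u, v}" using edge_doubleton by blast
  then have "u \<noteq> v" using e edge_ends(3) by blast
  define f where "f = (\<lambda>w. if w = u then 1 else 0 :: real)"
  have "1 \<le> edge_diff f e powr p" using uv \<open>u \<noteq> v\<close> by (simp add: edge_diff_pair f_def)
  also have "\<dots> \<le> energy p E f"
    unfolding energy_def using e finite_E by (intro member_le_sum) auto
  finally show ?thesis by (intro exI[of _ f]) simp
qed

text \<open>The drop is bounded below, and the energy above, by a multiple of the same power of the
  oscillation; the quotient of the two constants bounds the gap from below.\<close>

lemma relaxation_gap_pos:
  assumes "1 < p"
  shows "0 < relaxation_gap p V E"
proof -
  obtain c where c: "0 < c" "\<And>f. \<exists>u\<in>V. c * osc V f powr p \<le> energy_drop p E f u"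
    using energy_drop_ge_osc_powr[OF assms] by blast
  have cardE: "0 < real (card E)" using finite_E E_nonempty by (simp add: card_gt_0_iff)
  have "c / real (card E) \<le> relaxation_gap p V E"
    unfolding relaxation_gap_def
  proof (rule cINF_greatest)
    show "{f. 0 < energy p E f} \<noteq> {}" using exists_positive_energy by auto
    fix f assume "f \<in> {f. 0 < energy p E f}"
    then have pos: "0 < energy p E f" by simp
    obtain u where u: "u \<in> V" "c * osc V f powr p \<le> energy_drop p E f u" using c(2) by blast
    have "c * energy p E f \<le> c * (real (card E) * osc V f powr p)"
      using energy_le_osc_powr[OF assms, of f] c(1) by (intro mult_left_mono) auto
    also have "\<dots> = real (card E) * (c * osc V f powr p)" by simp
    also have "\<dots> \<le> real (card E) * energy_drop p E f u"
      using u by (intro mult_left_mono) auto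
    also have "energy_drop p E f u \<le> (\<Sum>u\<in>V. energy_drop p E f u)"
      using u finite_V energy_drop_nonneg[OF assms] by (intro member_le_sum) auto
    finally have "c * energy p E f \<le> real (card E) * (\<Sum>u\<in>V. energy_drop p E f u)"
      by (simp add: mult_left_mono)
    then show "c / real (card E) \<le> (\<Sum>u\<in>V. energy_drop p E f u) / energy p E f"
      using pos cardE by (simp add: field_simps)
  qed
  moreover have "0 < c / real (card E)" using c cardE by simp
  ultimately show ?thesis by linarith
qed

text \<open>For profiles of energy zero, over which the infimum does not range, this is nonnegativity of
  the drops.\<close>

lemma relaxation_gap_mult_energy_le:
  assumes "1 < p"
  shows "relaxation_gap p V E * energy p E f \<le> (\<Sum>u\<in>V. energy_drop p E f u)"
proof (cases "0 < energy p E f")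
  case True
  have "bdd_below ((\<lambda>f. (\<Sum>u\<in>V. energy_drop p E f u) / energy p E f) ` {f. energy p E f > 0})"
    using energy_drop_nonneg[OF assms] by (intro bdd_belowI[of _ 0]) (auto intro!: divide_nonneg_pos sum_nonneg)
  then have "relaxation_gap p V E \<le> (\<Sum>u\<in>V. energy_drop p E f u) / energy p E f"
    unfolding relaxation_gap_def using True by (intro cINF_lower) auto
  then show ?thesis using True by (simp add: field_simps)
next
  case False
  then have "energy p E f = 0" using energy_nonneg[of p f] by linarith
  then show ?thesis using energy_drop_nonneg[OF assms] by (simp add: sum_nonneg)
qed

text \<open>Ensures that \<open>1 - \<lambda>/n\<close>, the rate of decay of the expected energy, is nonnegative.\<close>

lemma relaxation_gap_le_card:
  assumes "1 < p"
  shows "relaxation_gap p V E \<le> real (card V)"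
proof -
  obtain f where f: "0 < energy p E f" using exists_positive_energy by blast
  have "relaxation_gap p V E * energy p E f \<le> (\<Sum>u\<in>V. energy_drop p E f u)"
    by (rule relaxation_gap_mult_energy_le[OF assms])
  also have "\<dots> \<le> (\<Sum>u\<in>V. energy p E f)" by (intro sum_mono energy_drop_le_energy)
  finally show ?thesis using f by simp
qed

section \<open>Oscillation and energy\<close>

lemma relpow_graph_dist:
  assumes "a \<in> V" "b \<in> V"
  shows "(a, b) \<in> adj_rel E ^^ graph_dist E a b"
proof -
  obtain k where "(a, b) \<in> adj_rel E ^^ k"
    using connected assms by (auto simp: graph_connected_def rtrancl_power)
  then show ?thesis unfolding graph_dist_def by (rule LeastI)
qed

lemma graph_dist_le: "(a, b) \<in> adj_rel E ^^ k \<Longrightarrow> graph_dist E a b \<le> k"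
  unfolding graph_dist_def by (rule Least_le)

lemma graph_dist_le_diameter:
  assumes "a \<in> V" "b \<in> V"
  shows "graph_dist E a b \<le> graph_diameter V E"
proof -
  have "finite {graph_dist E u v | u v. u \<in> V \<and> v \<in> V}"
    using finite_V by (intro finite_image_set2) auto
  then show ?thesis unfolding graph_diameter_def using assms by (intro Max_ge) auto
qed

text \<open>The \<open>i\<close>-th vertex of a shortest walk has distance \<open>i\<close> from the start. An edge of the walk is
  therefore determined by the distances of its ends, and no edge is used twice.\<close>

lemma shortest_walk:
  assumes "a \<in> V" "b \<in> V"
  shows "\<exists>w. w 0 = a \<and> w (graph_dist E a b) = b \<and>
    (\<forall>i<graph_dist E a b. {w i, w (Suc i)} \<in> E) \<and>
    inj_on (\<lambda>i. {w i, w (Suc i)}) {..<graph_dist E a b}"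
proof -
  define k where "k = graph_dist E a b"
  have "(a, b) \<in> adj_rel E ^^ k" using relpow_graph_dist[OF assms] by (simp add: k_def)
  then obtain w where w: "w 0 = a" "w k = b" "\<And>i. i < k \<Longrightarrow> (w i, w (Suc i)) \<in> adj_rel E"
    unfolding relpow_fun_conv by blast
  have dist: "graph_dist E a (w i) = i" if "i \<le> k" for i
  proof (rule antisym)
    have head: "(a, w i) \<in> adj_rel E ^^ i"
      unfolding relpow_fun_conv using w that by (intro exI[of _ w]) auto
    then show "graph_dist E a (w i) \<le> i" by (rule graph_dist_le)
    have "(a, w i) \<in> adj_rel E ^^ graph_dist E a (w i)"
      unfolding graph_dist_def using head by (rule LeastI)
    moreover have "(w i, b) \<in> adj_rel E ^^ (k - i)"
      unfolding relpow_fun_conv using w that by (intro exI[of _ "\<lambda>j. w (i + j)"]) auto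
    ultimately have "(a, b) \<in> adj_rel E ^^ (graph_dist E a (w i) + (k - i))"
      by (rule relpow_trans)
    from graph_dist_le[OF this] show "i \<le> graph_dist E a (w i)" using that by (simp add: k_def)
  qed
  have "inj_on (\<lambda>i. {w i, w (Suc i)}) {..<k}"
  proof (rule inj_onI)
    fix i j assume i: "i \<in> {..<k}" and j: "j \<in> {..<k}"
      and eq: "{w i, w (Suc i)} = {w j, w (Suc j)}"
    have "graph_dist E a ` {w i, w (Suc i)} = graph_dist E a ` {w j, w (Suc j)}" by (simp only: eq)
    then have "{i, Suc i} = {j, Suc j}" using i j by (simp add: dist)
    then show "i = j" by (auto simp: doubleton_eq_iff)
  qed
  then show ?thesis using w unfolding k_def adj_rel_def by blast
qed

text \<open>The edges of a shortest walk from a minimum to a maximum are distinct, so that the sum of their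
  \<open>p\<close>-th powers is part of the energy.\<close>

lemma osc_powr_le_energy:
  assumes "1 < p"
  shows "osc V f powr p \<le> real (graph_diameter V E) powr (p - 1) * energy p E f"
proof -
  obtain a b where ab: "a \<in> V" "b \<in> V" "f a = Min (f ` V)" "f b = Max (f ` V)"
    using osc_attained by blast
  define k where "k = graph_dist E a b"
  obtain w where w: "w 0 = a" "w k = b" "\<And>i. i < k \<Longrightarrow> {w i, w (Suc i)} \<in> E"
    and inj: "inj_on (\<lambda>i. {w i, w (Suc i)}) {..<k}"
    using shortest_walk[OF ab(1,2)] unfolding k_def by blast
  have "osc V f = (\<Sum>i<k. f (w (Suc i)) - f (w i))"
    using sum_lessThan_telescope[of "\<lambda>i. f (w i)" k] ab w by (simp add: osc_def)
  also have "\<dots> \<le> (\<Sum>i<k. \<bar>f (w i) - f (w (Suc i))\<bar>)"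
    by (intro sum_mono) auto
  finally have "osc V f powr p \<le> (\<Sum>i<k. \<bar>f (w i) - f (w (Suc i))\<bar>) powr p"
    using \<open>1 < p\<close> osc_nonneg by (intro powr_mono2) auto
  also have "\<dots> \<le> real k powr (p - 1) * (\<Sum>i<k. \<bar>f (w i) - f (w (Suc i))\<bar> powr p)"
    using powr_sum_le_card_powr_mult_sum[OF \<open>1 < p\<close>, of "{..<k}" "\<lambda>i. \<bar>f (w i) - f (w (Suc i))\<bar>"]
    by simp
  also have "\<dots> \<le> real (graph_diameter V E) powr (p - 1) * energy p E f"
  proof (rule mult_mono)
    show "real k powr (p - 1) \<le> real (graph_diameter V E) powr (p - 1)"
      using graph_dist_le_diameter[OF ab(1,2)] \<open>1 < p\<close> by (intro powr_mono2) (auto simp: k_def)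
    have "(\<Sum>i<k. \<bar>f (w i) - f (w (Suc i))\<bar> powr p)
        = (\<Sum>e\<in>(\<lambda>i. {w i, w (Suc i)}) ` {..<k}. edge_diff f e powr p)"
      by (simp add: sum.reindex[OF inj] edge_diff_pair)
    also have "\<dots> \<le> energy p E f"
      unfolding energy_def using w finite_E by (intro sum_mono2) auto
    finally show "(\<Sum>i<k. \<bar>f (w i) - f (w (Suc i))\<bar> powr p) \<le> energy p E f" .
  qed (auto intro: sum_nonneg)
  finally show ?thesis .
qed

lemma diameter_pos: "0 < graph_diameter V E"
proof -
  obtain a where "a \<in> V" using V_nonempty by blast
  moreover obtain b where "b \<in> V" "b \<noteq> a" using exists_other_vertex by blast
  moreover have "graph_dist E a b \<noteq> 0"
  proof
    assume "graph_dist E a b = 0"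
    then have "(a, b) \<in> adj_rel E ^^ 0" using relpow_graph_dist[of a b] calculation by metis
    then show False using calculation by simp
  qed
  ultimately show ?thesis using graph_dist_le_diameter[of a b] by linarith
qed

section \<open>Decay of the mean energy\<close>

lemma sum_energy_update_le:
  assumes "1 < p"
  shows "(\<Sum>u\<in>V. energy p E (update p E f u))
    \<le> (real (card V) - relaxation_gap p V E) * energy p E f"
proof -
  have "(\<Sum>u\<in>V. energy_drop p E f u)
      = real (card V) * energy p E f - (\<Sum>u\<in>V. energy p E (update p E f u))"
    by (simp add: energy_drop_def sum_subtractf)
  with relaxation_gap_mult_energy_le[OF assms, of f] show ?thesis by (simp add: algebra_simps)
qed

lemma trajectory_cong:
  "(\<And>i. i \<in> {1..t} \<Longrightarrow> us i = vs i) \<Longrightarrow> trajectory p E f0 us t = trajectory p E f0 vs t"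
  by (induction t) auto

text \<open>Divided by \<open>n\<^sup>t\<close>, the left-hand side is the expected energy at time \<open>t\<close>. The induction splits off
  the last letter of the word, which the trajectory up to time \<open>t\<close> does not see.\<close>

lemma sum_energy_trajectory_le:
  assumes "1 < p"
  shows "(\<Sum>us\<in>PiE {1..t} (\<lambda>_. V). energy p E (trajectory p E f0 us t))
    \<le> (real (card V) - relaxation_gap p V E) ^ t * energy p E f0"
proof (induction t)
  case 0
  then show ?case by simp
next
  case (Suc t)
  have ins: "{1..Suc t} = insert (Suc t) {1..t}" by auto
  let ?r = "real (card V) - relaxation_gap p V E"
  let ?f = "\<lambda>us. trajectory p E f0 us t"
  have "(\<Sum>us\<in>PiE {1..Suc t} (\<lambda>_. V). energy p E (trajectory p E f0 us (Suc t)))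
      = (\<Sum>(u, us)\<in>V \<times> PiE {1..t} (\<lambda>_. V).
          energy p E (trajectory p E f0 (us(Suc t := u)) (Suc t)))"
    unfolding ins PiE_insert_eq
    by (subst sum.reindex[OF inj_combinator]) (auto simp: case_prod_unfold simp del: trajectory.simps)
  also have "\<dots> = (\<Sum>(u, us)\<in>V \<times> PiE {1..t} (\<lambda>_. V). energy p E (update p E (?f us) u))"
  proof (rule sum.cong, simp, clarify)
    fix u us
    have "trajectory p E f0 (us(Suc t := u)) t = ?f us" by (rule trajectory_cong) auto
    then show "energy p E (trajectory p E f0 (us(Suc t := u)) (Suc t)) = energy p E (update p E (?f us) u)"
      by simp
  qed
  also have "\<dots> = (\<Sum>us\<in>PiE {1..t} (\<lambda>_. V). \<Sum>u\<in>V. energy p E (update p E (?f us) u))"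
    by (subst sum.swap) (simp add: sum.cartesian_product)
  also have "\<dots> \<le> (\<Sum>us\<in>PiE {1..t} (\<lambda>_. V). ?r * energy p E (?f us))"
    by (intro sum_mono sum_energy_update_le assms)
  also have "\<dots> = ?r * (\<Sum>us\<in>PiE {1..t} (\<lambda>_. V). energy p E (?f us))"
    by (simp add: sum_distrib_left)
  also have "\<dots> \<le> ?r * (?r ^ t * energy p E f0)"
    using relaxation_gap_le_card[OF assms] by (intro mult_left_mono Suc.IH) auto
  finally show ?case by (simp add: mult.assoc)
qed

text \<open>Markov's inequality for the energy, in counting form: a large oscillation forces a large energy.\<close>

lemma card_large_osc_words_le:
  assumes "1 < p" "0 < \<epsilon>"
  shows "real (card {us \<in> PiE {1..t} (\<lambda>_. V). \<epsilon> < osc V (trajectory p E f0 us t)})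
    \<le> (real (card V) - relaxation_gap p V E) ^ t
        * (real (graph_diameter V E) powr (p - 1) * energy p E f0 / \<epsilon> powr p)"
proof -
  let ?W = "PiE {1..t} (\<lambda>_. V)"
  let ?B = "{us \<in> ?W. \<epsilon> < osc V (trajectory p E f0 us t)}"
  let ?K = "real (graph_diameter V E) powr (p - 1)"
  have fin: "finite ?W" using finite_V by (intro finite_PiE) auto
  have "real (card ?B) * \<epsilon> powr p = (\<Sum>us\<in>?B. \<epsilon> powr p)" by simp
  also have "\<dots> \<le> (\<Sum>us\<in>?B. ?K * energy p E (trajectory p E f0 us t))"
  proof (rule sum_mono)
    fix us assume "us \<in> ?B"
    then have "\<epsilon> powr p \<le> osc V (trajectory p E f0 us t) powr p"
      using assms by (intro powr_mono2) auto
    then show "\<epsilon> powr p \<le> ?K * energy p E (trajectory p E f0 us t)"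
      using osc_powr_le_energy[OF \<open>1 < p\<close>] order_trans by blast
  qed
  also have "\<dots> \<le> (\<Sum>us\<in>?W. ?K * energy p E (trajectory p E f0 us t))"
    using fin by (intro sum_mono2) (auto intro: mult_nonneg_nonneg energy_nonneg)
  also have "\<dots> = ?K * (\<Sum>us\<in>?W. energy p E (trajectory p E f0 us t))"
    by (simp add: sum_distrib_left)
  also have "\<dots> \<le> ?K * ((real (card V) - relaxation_gap p V E) ^ t * energy p E f0)"
    by (intro mult_left_mono sum_energy_trajectory_le assms) auto
  finally show ?thesis using \<open>0 < \<epsilon>\<close> by (simp add: field_simps)
qed

end

section \<open>Uniform random words\<close>

lemma (in prob_space) prob_uniform_prefix:
  assumes "finite V" and indep: "indep_vars (\<lambda>_. count_space V) U {1..}"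
    and unif: "\<forall>t\<ge>1. distr M (count_space V) (U t) = uniform_count_measure V"
    and a: "a \<in> PiE {1..t} (\<lambda>_. V)"
  shows "prob {\<omega> \<in> space M. \<forall>i\<in>{1..t}. U i \<omega> = a i} = 1 / real (card V) ^ t"
proof (cases "t = 0")
  case True
  then show ?thesis by (simp add: prob_space)
next
  case False
  have rv: "U i \<in> measurable M (count_space V)" if "1 \<le> i" for i
    using indep that by (auto simp: indep_vars_def)
  have one: "prob (U i -` {a i} \<inter> space M) = 1 / real (card V)" if i: "i \<in> {1..t}" for i
  proof -
    have "a i \<in> V" using a i by auto
    then have "prob (U i -` {a i} \<inter> space M) = measure (distr M (count_space V) (U i)) {a i}"
      using rv i by (subst measure_distr) auto
    also have "\<dots> = 1 / real (card V)"
      using unif i \<open>a i \<in> V\<close> \<open>finite V\<close> by (simp add: measure_uniform_count_measure)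
    finally show ?thesis .
  qed
  have "{\<omega> \<in> space M. \<forall>i\<in>{1..t}. U i \<omega> = a i} = (\<Inter>i\<in>{1..t}. U i -` {a i} \<inter> space M)"
    using False by auto
  also have "prob \<dots> = (\<Prod>i\<in>{1..t}. prob (U i -` {a i} \<inter> space M))"
    using a False by (intro indep_varsD[OF indep]) auto
  also have "\<dots> = (\<Prod>i\<in>{1..t}. 1 / real (card V))"
    by (rule prod.cong) (simp_all only: one)
  also have "\<dots> = 1 / real (card V) ^ t" by (simp add: power_one_over)
  finally show ?thesis .
qed

text \<open>An event about the first \<open>t\<close> letters is a finite disjoint union of cylinders. This also provides
  its measurability, although profiles and words carry no \<open>\<sigma>\<close>-algebra here.\<close>

lemma (in prob_space) prob_of_prefix_event:
  assumes "finite V" and indep: "indep_vars (\<lambda>_. count_space V) U {1..}"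
    and unif: "\<forall>t\<ge>1. distr M (count_space V) (U t) = uniform_count_measure V"
    and prefix: "\<And>us vs. (\<And>i. i \<in> {1..t} \<Longrightarrow> us i = vs i) \<Longrightarrow> Q us \<longleftrightarrow> Q vs"
  shows "{\<omega> \<in> space M. Q (\<lambda>i. U i \<omega>)} \<in> events"
    and "prob {\<omega> \<in> space M. Q (\<lambda>i. U i \<omega>)}
      = real (card {us \<in> PiE {1..t} (\<lambda>_. V). Q us}) / real (card V) ^ t"
proof -
  let ?C = "\<lambda>a. {\<omega> \<in> space M. \<forall>i\<in>{1..t}. U i \<omega> = a i}"
  let ?A = "{us \<in> PiE {1..t} (\<lambda>_. V). Q us}"
  have fin: "finite ?A" using \<open>finite V\<close> by (intro finite_subset[OF _ finite_PiE[of "{1..t}" "\<lambda>_. V"]]) auto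
  have rv: "U i \<in> measurable M (count_space V)" if "1 \<le> i" for i
    using indep that by (auto simp: indep_vars_def)
  have meas: "?C a \<in> events" if "a \<in> PiE {1..t} (\<lambda>_. V)" for a
  proof -
    have "{\<omega> \<in> space M. U i \<omega> = a i} \<in> events" if i: "i \<in> {1..t}" for i
    proof -
      have "U i -` {a i} \<inter> space M \<in> events"
        using rv[of i] i \<open>a \<in> _\<close> by (intro measurable_sets[where A = "count_space V"]) auto
      moreover have "U i -` {a i} \<inter> space M = {\<omega> \<in> space M. U i \<omega> = a i}" by auto
      ultimately show ?thesis by simp
    qed
    then show ?thesis by (intro sets.sets_Collect_finite_All) auto
  qed
  have union: "{\<omega> \<in> space M. Q (\<lambda>i. U i \<omega>)} = (\<Union>a\<in>?A. ?C a)"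
  proof (intro subset_antisym subsetI)
    fix \<omega> assume \<omega>: "\<omega> \<in> {\<omega> \<in> space M. Q (\<lambda>i. U i \<omega>)}"
    define a where "a = restrict (\<lambda>i. U i \<omega>) {1..t}"
    have "a \<in> PiE {1..t} (\<lambda>_. V)"
      using measurable_space[OF rv] \<omega> by (auto simp: a_def)
    moreover have "Q a \<longleftrightarrow> Q (\<lambda>i. U i \<omega>)" by (rule prefix) (simp add: a_def)
    moreover have "\<omega> \<in> ?C a" using \<omega> by (simp add: a_def)
    ultimately show "\<omega> \<in> (\<Union>a\<in>?A. ?C a)" using \<omega> by blast
  next
    fix \<omega> assume "\<omega> \<in> (\<Union>a\<in>?A. ?C a)"
    then obtain a where "a \<in> ?A" "\<omega> \<in> ?C a" by blast
    moreover from this have "Q a \<longleftrightarrow> Q (\<lambda>i. U i \<omega>)" by (intro prefix) auto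
    ultimately show "\<omega> \<in> {\<omega> \<in> space M. Q (\<lambda>i. U i \<omega>)}" by blast
  qed
  show "{\<omega> \<in> space M. Q (\<lambda>i. U i \<omega>)} \<in> events"
    unfolding union using fin meas by (intro sets.finite_UN) auto
  have "disjoint_family_on ?C ?A"
  proof (unfold disjoint_family_on_def, intro ballI impI)
    fix a b assume "a \<in> ?A" "b \<in> ?A" "a \<noteq> b"
    then have "\<exists>i\<in>{1..t}. a i \<noteq> b i" using PiE_ext[of a "{1..t}" "\<lambda>_. V" b] by blast
    then show "?C a \<inter> ?C b = {}" by force
  qed
  then have "prob (\<Union>a\<in>?A. ?C a) = (\<Sum>a\<in>?A. prob (?C a))"
    using fin meas by (intro finite_measure_finite_Union) auto
  also have "\<dots> = (\<Sum>a\<in>?A. 1 / real (card V) ^ t)"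
    using prob_uniform_prefix[OF \<open>finite V\<close> indep unif] by (intro sum.cong) auto
  finally show "prob {\<omega> \<in> space M. Q (\<lambda>i. U i \<omega>)} = real (card ?A) / real (card V) ^ t"
    unfolding union by simp
qed

section \<open>The expected hitting time\<close>

text \<open>Split at \<open>T = \<lceil>ln A / q\<rceil>\<close>, the time at which \<open>A (1 - q)\<^sup>t\<close> is at most 1. The first \<open>T\<close>
  terms contribute at most \<open>ln A / q + 1\<close> and the others at most \<open>1 / q\<close>; since \<open>q \<le> 1\<close>, the rounding
  is absorbed in another \<open>1 / q\<close>.\<close>

lemma suminf_ennreal_geometric_tail_le:
  fixes P :: "nat \<Rightarrow> real"
  assumes "0 < q" "q \<le> 1" "1 \<le> A"
    and P: "\<And>t. 0 \<le> P t" "\<And>t. P t \<le> 1" "\<And>t. P t \<le> A * (1 - q) ^ t"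
  shows "(\<Sum>t. ennreal (P t)) \<le> ennreal (1 / q * (ln A + 2))"
proof -
  define T where "T = nat \<lceil>ln A / q\<rceil>"
  have lnA: "0 \<le> ln A / q" using assms by simp
  have T_ge: "ln A / q \<le> real T" unfolding T_def by (rule real_nat_ceiling_ge)
  have T_le: "real T \<le> ln A / q + 1" unfolding T_def using lnA by linarith
  have small: "A * (1 - q) ^ T \<le> 1"
  proof -
    have "(1 - q) ^ T \<le> exp (- q) ^ T"
      using assms exp_ge_add_one_self[of "- q"] by (intro power_mono) auto
    also have "\<dots> = exp (- (q * real T))" by (simp add: exp_of_nat_mult[symmetric] mult.commute)
    also have "\<dots> \<le> exp (- ln A)" using T_ge \<open>0 < q\<close> by (simp add: field_simps)
    also have "\<dots> = 1 / A" using \<open>1 \<le> A\<close> by (simp add: exp_minus field_simps)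
    finally show ?thesis using \<open>1 \<le> A\<close> by (simp add: field_simps)
  qed
  define g where "g t = (if t < T then 1 else A * (1 - q) ^ t)" for t
  have g_shift: "(\<lambda>t. g (t + T)) = (\<lambda>t. A * (1 - q) ^ T * (1 - q) ^ t)"
    by (auto simp: g_def power_add fun_eq_iff)
  have geo: "(\<lambda>t. (1 - q) ^ t) sums (1 / q)"
    using geometric_sums[of "1 - q"] assms by simp
  have "(\<lambda>t. g (t + T)) sums (A * (1 - q) ^ T * (1 / q))"
    unfolding g_shift by (rule sums_mult[OF geo])
  then have "g sums (A * (1 - q) ^ T * (1 / q) + (\<Sum>t<T. g t))"
    by (simp only: sums_iff_shift)
  then have g: "g sums (A * (1 - q) ^ T * (1 / q) + real T)" by (simp add: g_def)
  have "(\<Sum>t. ennreal (P t)) \<le> (\<Sum>t. ennreal (g t))"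
    using P by (intro suminf_le ennreal_leI) (auto simp: g_def)
  also have "\<dots> = ennreal (\<Sum>t. g t)"
    using assms by (intro suminf_ennreal2 sums_summable[OF g]) (auto simp: g_def)
  also have "(\<Sum>t. g t) = A * (1 - q) ^ T * (1 / q) + real T" by (rule sums_unique[OF g, symmetric])
  also have "ennreal \<dots> \<le> ennreal (1 / q * (ln A + 2))"
  proof (rule ennreal_leI)
    have "A * (1 - q) ^ T * (1 / q) \<le> 1 / q" using small \<open>0 < q\<close> by (simp add: field_simps)
    moreover have "1 \<le> 1 / q" using assms by simp
    moreover have "1 / q * (ln A + 2) = ln A / q + 1 / q + 1 / q" using \<open>0 < q\<close> by (simp add: field_simps)
    ultimately show "A * (1 - q) ^ T * (1 / q) + real T \<le> 1 / q * (ln A + 2)" using T_le by linarith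
  qed
  finally show ?thesis .
qed

text \<open>The hitting time counts the times before the first visit, and at each of them the oscillation
  is large. Counting all times of large oscillation avoids proving that the hitting time itself
  is measurable.\<close>

lemma ennreal_hitting_time_le:
  "ennreal_of_enat (hitting_time p V E \<epsilon> f0 us)
    \<le> (\<Sum>t. if \<epsilon> < osc V (trajectory p E f0 us t) then 1 else 0)"
proof -
  define \<tau> where "\<tau> = hitting_time p V E \<epsilon> f0 us"
  have not_hit: "\<epsilon> < osc V (trajectory p E f0 us t)" if "enat t < \<tau>" for t
  proof (rule ccontr)
    assume "\<not> ?thesis"
    then have "\<tau> \<le> enat t" unfolding \<tau>_def hitting_time_def by (intro Inf_lower) auto
    then show False using that by simp
  qed
  have "(\<lambda>t::nat. if t < \<tau> then 1 else 0) sums ennreal_of_enat \<tau>"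
    using sums_If_finite[of "\<lambda>r. r < \<tau>" "\<lambda>_. 1 :: ennreal"]
    by (cases \<tau>) (simp_all add: sums_def of_nat_tendsto_top_ennreal)
  then have "ennreal_of_enat \<tau> = (\<Sum>t::nat. if t < \<tau> then 1 else 0)" by (simp add: sums_iff)
  also have "\<dots> \<le> (\<Sum>t. if \<epsilon> < osc V (trajectory p E f0 us t) then 1 else 0)"
    using not_hit by (intro suminf_le) auto
  finally show ?thesis by (simp add: \<tau>_def)
qed

theorem theorem4p2:
  fixes V :: "'a set" and E :: "'a set set" and p \<epsilon> :: real and f0 :: "'a \<Rightarrow> real"
    and M :: "'w measure" and U :: "nat \<Rightarrow> 'w \<Rightarrow> 'a"
  assumes "finite V" and "simple_graph V E" and "graph_connected V E" and "card V \<ge> 2"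
    and "1 < p"
    and "\<forall>v\<in>V. f0 v \<in> {-1..1}"
    and "0 < \<epsilon>" and "\<epsilon> \<le> 1"
    and "prob_space M"
    and "prob_space.indep_vars M (\<lambda>_. count_space V) U {1..}"
    and "\<forall>t\<ge>1. distr M (count_space V) (U t) = uniform_count_measure V"
  shows "(\<integral>\<^sup>+ \<omega>. ennreal_of_enat (hitting_time p V E \<epsilon> f0 (\<lambda>t. U t \<omega>)) \<partial>M)
    \<le> ennreal (real (card V) / relaxation_gap p V E *
        (ln (2 powr p * real (card E) * real (graph_diameter V E) powr (p - 1) / \<epsilon> powr p) + 3))"
proof -
  interpret prob_space M by fact
  interpret finite_connected_graph V E using assms by unfold_locales
  define n where "n = real (card V)"
  define gap where "gap = relaxation_gap p V E"
  define D where "D = real (graph_diameter V E)"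
  define A where "A = 2 powr p * real (card E) * D powr (p - 1) / \<epsilon> powr p"
  define q where "q = gap / n"
  define B where "B t = {\<omega> \<in> space M. \<epsilon> < osc V (trajectory p E f0 (\<lambda>i. U i \<omega>) t)}" for t
  have n: "0 < n" using \<open>card V \<ge> 2\<close> by (simp add: n_def)
  have q: "0 < q" "q \<le> 1"
    using relaxation_gap_pos[OF \<open>1 < p\<close>] relaxation_gap_le_card[OF \<open>1 < p\<close>] n
    by (auto simp: q_def gap_def n_def)
  have A: "1 \<le> A"
  proof -
    have "1 \<le> real (card E)"
      using finite_E E_nonempty by (simp add: Suc_le_eq card_gt_0_iff)
    moreover have "1 \<le> D powr (p - 1)"
      using diameter_pos \<open>1 < p\<close> by (intro ge_one_powr_ge_zero) (auto simp: D_def)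
    moreover have "1 \<le> 2 powr p" using \<open>1 < p\<close> by (intro ge_one_powr_ge_zero) auto
    ultimately have "1 * 1 * 1 \<le> 2 powr p * real (card E) * D powr (p - 1)"
      by (intro mult_mono) auto
    moreover have "\<epsilon> powr p \<le> 1"
      using assms powr_mono2[of p \<epsilon> 1] by simp
    ultimately show ?thesis using \<open>0 < \<epsilon>\<close> by (simp add: A_def)
  qed
  have "osc V f0 \<le> 2"
  proof -
    obtain a b where "a \<in> V" "b \<in> V" "f0 a = Min (f0 ` V)" "f0 b = Max (f0 ` V)"
      using osc_attained by blast
    moreover from this have "- 1 \<le> f0 a" "f0 b \<le> 1" using assms(6) by auto
    ultimately show ?thesis by (simp add: osc_def)
  qed
  then have "osc V f0 powr p \<le> 2 powr p"
    using \<open>1 < p\<close> osc_nonneg by (intro powr_mono2) auto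
  then have energy0: "energy p E f0 \<le> real (card E) * 2 powr p"
    using energy_le_osc_powr[OF \<open>1 < p\<close>, of f0] by (meson mult_left_mono of_nat_0_le_iff order_trans)
  have prefix: "(\<epsilon> < osc V (trajectory p E f0 us t)) = (\<epsilon> < osc V (trajectory p E f0 vs t))"
    if "\<And>i. i \<in> {1..t} \<Longrightarrow> us i = vs i" for us vs t
    using trajectory_cong[OF that] by simp
  have B_events: "B t \<in> events" for t
    unfolding B_def using prob_of_prefix_event(1)[OF assms(1,10,11) prefix] .
  have prob_B: "prob (B t) \<le> A * (1 - q) ^ t" for t
  proof -
    have "prob (B t) = real (card {us \<in> PiE {1..t} (\<lambda>_. V). \<epsilon> < osc V (trajectory p E f0 us t)}) / n ^ t"
      unfolding B_def n_def using prob_of_prefix_event(2)[OF assms(1,10,11) prefix] .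
    also have "\<dots> \<le> ((n - gap) ^ t * (D powr (p - 1) * energy p E f0 / \<epsilon> powr p)) / n ^ t"
      using card_large_osc_words_le[OF \<open>1 < p\<close> \<open>0 < \<epsilon>\<close>, of t f0] n
      by (intro divide_right_mono) (auto simp: n_def gap_def D_def)
    also have "\<dots> = (1 - q) ^ t * (D powr (p - 1) * energy p E f0 / \<epsilon> powr p)"
    proof -
      have "1 - q = (n - gap) / n" using n by (simp add: q_def field_simps)
      then show ?thesis by (simp add: power_divide)
    qed
    also have "\<dots> \<le> (1 - q) ^ t * (D powr (p - 1) * (real (card E) * 2 powr p) / \<epsilon> powr p)"
      using energy0 q by (intro mult_left_mono divide_right_mono) auto
    also have "\<dots> = A * (1 - q) ^ t" by (simp add: A_def)
    finally show ?thesis .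
  qed
  have "(\<integral>\<^sup>+ \<omega>. ennreal_of_enat (hitting_time p V E \<epsilon> f0 (\<lambda>t. U t \<omega>)) \<partial>M)
      \<le> (\<integral>\<^sup>+ \<omega>. (\<Sum>t. indicator (B t) \<omega>) \<partial>M)"
  proof (rule nn_integral_mono)
    fix \<omega> assume "\<omega> \<in> space M"
    then have "(\<Sum>t. indicator (B t) \<omega>)
        = (\<Sum>t. if \<epsilon> < osc V (trajectory p E f0 (\<lambda>i. U i \<omega>) t) then 1 else 0 :: ennreal)"
      by (intro arg_cong[where f = suminf]) (auto simp: B_def fun_eq_iff)
    then show "ennreal_of_enat (hitting_time p V E \<epsilon> f0 (\<lambda>t. U t \<omega>)) \<le> (\<Sum>t. indicator (B t) \<omega>)"
      using ennreal_hitting_time_le[of p V E \<epsilon> f0 "\<lambda>t. U t \<omega>"] by simp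
  qed
  also have "\<dots> = (\<Sum>t. emeasure M (B t))"
    using B_events by (simp add: nn_integral_suminf)
  also have "\<dots> = (\<Sum>t. ennreal (prob (B t)))" by (simp add: emeasure_eq_measure)
  also have "\<dots> \<le> ennreal (1 / q * (ln A + 2))"
    using q A prob_B by (intro suminf_ennreal_geometric_tail_le) auto
  also have "\<dots> \<le> ennreal (1 / q * (ln A + 3))"
    using q by (intro ennreal_leI mult_left_mono) auto
  finally show ?thesis by (simp add: q_def A_def n_def gap_def D_def)
qed

end
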